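(* Let $\Omega$ be a finite set, let $G\le\mathrm{Sym}(\Omega)$ be an abelian permutation group, and let $Z=\mathrm{Zel}(G)$. Then $G$ is $2$-closed if and only if $Z\le G$ and $G^{\mathrm{Orb}(Z)}$ is $2$-closed.
   Context: For a finite set $\Omega$ and $H\le\mathrm{Sym}(\Omega)$, $\mathrm{Orb}(H)$ is the set of $H$-orbits on $\Omega$ and $\mathrm{Orb}_2(H)$ is the set of orbits of the induced (componentwise) action of $H$ on $\Omega\times\Omega$. The $2$-closure $\overline{H}$ is the largest subgroup of $\mathrm{Sym}(\Omega)$ with $\mathrm{Orb}_2(\overline{H})=\mathrm{Orb}_2(H)$; $H$ is $2$-closed if $H=\overline{H}$ (the same definition applies to permutation groups on any finite set). If $\Delta\subseteq\Omega$ is $H$-invariant, $H^\Delta\le\mathrm{Sym}(\Delta)$ is the permutation group induced by $H$ on $\Delta$; $H_{\Delta}$ denotes the pointwise stabilizer of $\Delta$ in $H$. For orbits $\Delta,\Delta'$ of $G$ put $G_{\Delta'}^{\Delta}=(G_{\Delta'})^{\Delta}$. Define $$\mathrm{Zel}(G)=\prod_{\Delta\in\mathrm{Orb}(G)}\ \bigcap_{\Delta'\in\mathrm{Orb}(G),\ \Delta'\ne\Delta}G_{\Delta'}^{\Delta}\ \le\ \mathrm{Sym}(\Omega),$$ a direct product in which the factor indexed by $\Delta$ acts on $\Delta$ and fixes $\Omega\setminus\Delta$ pointwise; the intersection is taken among subgroups of $G^\Delta$ (so it equals $G^\Delta$ if $G$ has only one orbit). Since each factor of $Z=\mathrm{Zel}(G)$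 is a normal subgroup of $G^\Delta$, the group $G$ permutes the $Z$-orbits on $\Omega$ (even if $Z\not\le G$); $G^{\mathrm{Orb}(Z)}\le\mathrm{Sym}(\mathrm{Orb}(Z))$ denotes the permutation group induced by this action of $G$ on the set $\mathrm{Orb}(Z)$. *)

theory Defs
  imports "HOL-Algebra.Group_Action"
begin

text \<open>
  Sym(\<open>\<Omega>\<close>) is the library group \<^term>\<open>BijGroup \<Omega>\<close>, whose elements are the bijections of \<open>\<Omega>\<close>
  that are \<^const>\<open>undefined\<close> outside \<open>\<Omega>\<close>. A permutation group on \<open>\<Omega>\<close> is the carrier
  \<open>H\<close> of a subgroup of \<^term>\<open>BijGroup \<Omega>\<close>.
\<close>

abbreviation perm_group :: "'a set \<Rightarrow> ('a \<Rightarrow> 'a) set \<Rightarrow> ('a \<Rightarrow> 'a) monoid"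
  where "perm_group \<Omega> H \<equiv> BijGroup \<Omega> \<lparr>carrier := H\<rparr>"

definition Orb :: "'a set \<Rightarrow> ('a \<Rightarrow> 'a) set \<Rightarrow> 'a set set"
  where "Orb \<Omega> H = orbits (perm_group \<Omega> H) \<Omega> (\<lambda>g. g)"

definition Orb2 :: "'a set \<Rightarrow> ('a \<Rightarrow> 'a) set \<Rightarrow> ('a \<times> 'a) set set"
  where "Orb2 \<Omega> H = orbits (perm_group \<Omega> H) (\<Omega> \<times> \<Omega>) (\<lambda>g. restrict (map_prod g g) (\<Omega> \<times> \<Omega>))"

text \<open>
  The greatest element is taken with respect to inclusion; its existence is
  \<open>two_closure_is_greatest\<close> below.
\<close>

definition two_closure :: "'a set \<Rightarrow> ('a \<Rightarrow> 'a) set \<Rightarrow> ('a \<Rightarrow> 'a) set"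
  where "two_closure \<Omega> H =
    (GREATEST K. subgroup K (BijGroup \<Omega>) \<and> Orb2 \<Omega> K = Orb2 \<Omega> H)"

definition two_closed :: "'a set \<Rightarrow> ('a \<Rightarrow> 'a) set \<Rightarrow> bool"
  where "two_closed \<Omega> H \<longleftrightarrow> H = two_closure \<Omega> H"

definition induced :: "('a \<Rightarrow> 'a) set \<Rightarrow> 'a set \<Rightarrow> ('a \<Rightarrow> 'a) set"
  where "induced H \<Delta> = (\<lambda>g. restrict g \<Delta>) ` H"

definition pointwise_stabilizer :: "('a \<Rightarrow> 'a) set \<Rightarrow> 'a set \<Rightarrow> ('a \<Rightarrow> 'a) set"
  where "pointwise_stabilizer H \<Delta> = {g \<in> H. \<forall>x\<in>\<Delta>. g x = x}"

text \<open>
  Intersecting with \<^term>\<open>induced G \<Delta>\<close> matters only if \<open>\<Delta>\<close> is the only orbit.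
\<close>

definition Zel_factor :: "'a set \<Rightarrow> ('a \<Rightarrow> 'a) set \<Rightarrow> 'a set \<Rightarrow> ('a \<Rightarrow> 'a) set"
  where "Zel_factor \<Omega> G \<Delta> =
    induced G \<Delta> \<inter> (\<Inter>\<Delta>' \<in> Orb \<Omega> G - {\<Delta>}. induced (pointwise_stabilizer G \<Delta>') \<Delta>)"

text \<open>
  A family \<open>f\<close> in the direct product of the factors acts on the disjoint union \<open>\<Omega>\<close> of the
  orbits of \<open>G\<close> by applying \<open>f \<Delta>\<close> to the points of \<open>\<Delta>\<close>.
\<close>

definition Zel :: "'a set \<Rightarrow> ('a \<Rightarrow> 'a) set \<Rightarrow> ('a \<Rightarrow> 'a) set"
  where "Zel \<Omega> G =
    (\<lambda>f. \<lambda>x\<in>\<Omega>. f (orbit (perm_group \<Omega> G) (\<lambda>g. g) x) x) ` (\<Pi>\<^sub>E \<Delta> \<in> Orb \<Omega> G. Zel_factor \<Omega> G \<Delta>)"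

text \<open>
  The group induced on a set \<open>\<B>\<close> of blocks that is permuted by \<open>G\<close>, as a permutation group on \<open>\<B>\<close>.
\<close>

definition induced_on_blocks :: "('a \<Rightarrow> 'a) set \<Rightarrow> 'a set set \<Rightarrow> ('a set \<Rightarrow> 'a set) set"
  where "induced_on_blocks G \<B> = (\<lambda>g. \<lambda>B\<in>\<B>. g ` B) ` G"

lemma subgroup_BijGroup_iff:
  "subgroup H (BijGroup \<Omega>) \<longleftrightarrow>
     H \<subseteq> Bij \<Omega> \<and> (\<lambda>x\<in>\<Omega>. x) \<in> H \<and> (\<forall>f\<in>H. \<forall>g\<in>H. compose \<Omega> f g \<in> H) \<and>
     (\<forall>f\<in>H. (\<lambda>x\<in>\<Omega>. inv_into \<Omega> f x) \<in> H)"
  (is "?L \<longleftrightarrow> ?R")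
proof
  assume ?L
  then interpret subgroup H "BijGroup \<Omega>" .
  have sub: "H \<subseteq> Bij \<Omega>"
    using subset by (simp add: BijGroup_def)
  moreover have "(\<lambda>x\<in>\<Omega>. x) \<in> H"
    using one_closed by (simp add: BijGroup_def)
  moreover have "compose \<Omega> f g \<in> H" if "f \<in> H" "g \<in> H" for f g
    using m_closed[OF that] that sub by (simp add: BijGroup_def subset_iff)
  moreover have "(\<lambda>x\<in>\<Omega>. inv_into \<Omega> f x) \<in> H" if "f \<in> H" for f
    using m_inv_closed[OF that] inv_BijGroup[OF subsetD[OF sub that]] by metis
  ultimately show ?R by blast
next
  assume R: ?R
  show ?L
  proof
    show "H \<subseteq> carrier (BijGroup \<Omega>)" "\<one>\<^bsub>BijGroup \<Omega>\<^esub> \<in> H"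
      using R by (simp_all add: BijGroup_def)
    show "f \<otimes>\<^bsub>BijGroup \<Omega>\<^esub> g \<in> H" if "f \<in> H" "g \<in> H" for f g
      using R that by (simp add: BijGroup_def subset_iff)
    show "inv\<^bsub>BijGroup \<Omega>\<^esub> f \<in> H" if "f \<in> H" for f
      using R that inv_BijGroup[of f \<Omega>] by (simp add: subset_iff)
  qed
qed

lemma Orb2_eq: "Orb2 \<Omega> H = {{(h x, h y) | h. h \<in> H} | x y. x \<in> \<Omega> \<and> y \<in> \<Omega>}"
proof -
  let ?o = "orbit (perm_group \<Omega> H) (\<lambda>g. restrict (map_prod g g) (\<Omega> \<times> \<Omega>))"
  have eq: "?o (x, y) = {(h x, h y) | h. h \<in> H}" if "x \<in> \<Omega>" "y \<in> \<Omega>" for x y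
    using that by (simp add: orbit_def)
  have "P \<in> Orb2 \<Omega> H \<longleftrightarrow> (\<exists>x y. P = {(h x, h y) | h. h \<in> H} \<and> x \<in> \<Omega> \<and> y \<in> \<Omega>)" for P
  proof -
    have "P \<in> Orb2 \<Omega> H \<longleftrightarrow> (\<exists>x y. P = ?o (x, y) \<and> x \<in> \<Omega> \<and> y \<in> \<Omega>)"
      by (simp add: Orb2_def orbits_def)
    also have "\<dots> \<longleftrightarrow> (\<exists>x y. P = {(h x, h y) | h. h \<in> H} \<and> x \<in> \<Omega> \<and> y \<in> \<Omega>)"
    proof (intro ex_cong1)
      show "(P = ?o (x, y) \<and> x \<in> \<Omega> \<and> y \<in> \<Omega>) \<longleftrightarrow>
          (P = {(h x, h y) | h. h \<in> H} \<and> x \<in> \<Omega> \<and> y \<in> \<Omega>)" for x y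
        by (cases "x \<in> \<Omega>"; cases "y \<in> \<Omega>") (simp_all only: eq simp_thms)
    qed
    finally show ?thesis .
  qed
  note mem = this
  show ?thesis by (rule Set.set_eqI, unfold mem mem_Collect_eq, rule refl)
qed

definition pairwise_hull :: "'a set \<Rightarrow> ('a \<Rightarrow> 'a) set \<Rightarrow> ('a \<Rightarrow> 'a) set"
  where "pairwise_hull \<Omega> H =
    {f \<in> Bij \<Omega>. \<forall>x\<in>\<Omega>. \<forall>y\<in>\<Omega>. \<exists>h\<in>H. h x = f x \<and> h y = f y}"

lemma pairwise_hullE:
  assumes "f \<in> pairwise_hull \<Omega> H" "x \<in> \<Omega>" "y \<in> \<Omega>"
  obtains h where "h \<in> H" "h x = f x" "h y = f y"
  using assms by (auto simp: pairwise_hull_def)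

lemma subgroup_pairwise_hull:
  assumes "subgroup H (BijGroup \<Omega>)"
  shows "subgroup (pairwise_hull \<Omega> H) (BijGroup \<Omega>)"
proof -
  note H = assms[unfolded subgroup_BijGroup_iff]
  have mem: "h x \<in> \<Omega>" if "h \<in> Bij \<Omega>" "x \<in> \<Omega>" for h x
    using that by (auto simp: Bij_def bij_betw_def)
  show ?thesis unfolding subgroup_BijGroup_iff
  proof (intro conjI ballI)
    show "pairwise_hull \<Omega> H \<subseteq> Bij \<Omega>" by (auto simp: pairwise_hull_def)
    show "(\<lambda>x\<in>\<Omega>. x) \<in> pairwise_hull \<Omega> H"
      using H by (auto simp: pairwise_hull_def id_Bij intro!: bexI[of _ "\<lambda>x\<in>\<Omega>. x"])
  next
    fix f g assume f: "f \<in> pairwise_hull \<Omega> H" and g: "g \<in> pairwise_hull \<Omega> H"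
    have "\<exists>h\<in>H. h x = compose \<Omega> f g x \<and> h y = compose \<Omega> f g y" if xy: "x \<in> \<Omega>" "y \<in> \<Omega>" for x y
    proof -
      obtain h where h: "h \<in> H" "h x = g x" "h y = g y"
        using pairwise_hullE[OF g xy] .
      have "g \<in> Bij \<Omega>" using g by (simp add: pairwise_hull_def)
      obtain k where k: "k \<in> H" "k (g x) = f (g x)" "k (g y) = f (g y)"
        using pairwise_hullE[OF f mem[OF \<open>g \<in> Bij \<Omega>\<close> xy(1)] mem[OF \<open>g \<in> Bij \<Omega>\<close> xy(2)]] .
      show ?thesis
        using H h k xy by (intro bexI[of _ "compose \<Omega> k h"]) (auto simp: compose_def)
    qed
    then show "compose \<Omega> f g \<in> pairwise_hull \<Omega> H"
      using f g by (simp add: pairwise_hull_def compose_Bij)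
  next
    fix f assume f: "f \<in> pairwise_hull \<Omega> H"
    then have fB: "f \<in> Bij \<Omega>" by (simp add: pairwise_hull_def)
    have "\<exists>h\<in>H. h x = (\<lambda>x\<in>\<Omega>. inv_into \<Omega> f x) x \<and> h y = (\<lambda>x\<in>\<Omega>. inv_into \<Omega> f x) y"
      if xy: "x \<in> \<Omega>" "y \<in> \<Omega>" for x y
    proof -
      let ?u = "inv_into \<Omega> f x" and ?v = "inv_into \<Omega> f y"
      have uv: "?u \<in> \<Omega>" "?v \<in> \<Omega>" "f ?u = x" "f ?v = y"
        using fB xy by (auto simp: Bij_inv_into_mem Bij_def bij_betw_def f_inv_into_f)
      obtain h where h: "h \<in> H" "h ?u = x" "h ?v = y"
        using pairwise_hullE[OF f uv(1,2)] unfolding uv(3,4) .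
      then have "inj_on h \<Omega>" using H by (auto simp: Bij_def bij_betw_def)
      then have "inv_into \<Omega> h x = ?u" "inv_into \<Omega> h y = ?v"
        using uv h by (intro inv_into_f_eq; simp)+
      then show ?thesis
        using H h xy by (intro bexI[of _ "\<lambda>x\<in>\<Omega>. inv_into \<Omega> h x"]) auto
    qed
    then show "(\<lambda>x\<in>\<Omega>. inv_into \<Omega> f x) \<in> pairwise_hull \<Omega> H"
      using fB by (simp add: pairwise_hull_def restrict_inv_into_Bij)
  qed
qed

lemma Orb2_pairwise_hull:
  assumes "subgroup H (BijGroup \<Omega>)"
  shows "Orb2 \<Omega> (pairwise_hull \<Omega> H) = Orb2 \<Omega> H"
proof -
  let ?O = "\<lambda>K x y. {(h x, h y) | h. h \<in> K}"
  have eq: "?O (pairwise_hull \<Omega> H) x y = ?O H x y" if xy: "x \<in> \<Omega>" "y \<in> \<Omega>" for x y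
  proof (intro equalityI subsetI)
    fix p assume "p \<in> ?O (pairwise_hull \<Omega> H) x y"
    then obtain f where f: "f \<in> pairwise_hull \<Omega> H" and p: "p = (f x, f y)" by blast
    then obtain h where "h \<in> H" "h x = f x" "h y = f y"
      using xy unfolding pairwise_hull_def by blast
    then have "p = (h x, h y)" "h \<in> H" using p by simp_all
    then show "p \<in> ?O H x y" by blast
  next
    have "H \<subseteq> pairwise_hull \<Omega> H"
      using assms unfolding pairwise_hull_def subgroup_BijGroup_iff by blast
    then show "p \<in> ?O (pairwise_hull \<Omega> H) x y" if "p \<in> ?O H x y" for p
      using that by blast
  qed
  have Orb2: "Orb2 \<Omega> K = (\<lambda>(x, y). ?O K x y) ` (\<Omega> \<times> \<Omega>)" for K
    unfolding Orb2_eq by (auto simp: image_iff)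
  show ?thesis
    unfolding Orb2[of H] Orb2[of "pairwise_hull \<Omega> H"]
  proof (rule image_cong[OF refl])
    show "(\<lambda>(x, y). ?O (pairwise_hull \<Omega> H) x y) p = (\<lambda>(x, y). ?O H x y) p" if "p \<in> \<Omega> \<times> \<Omega>" for p
      using that eq[of "fst p" "snd p"] unfolding case_prod_beta by (simp add: mem_Times_iff)
  qed
qed

lemma subset_pairwise_hull:
  assumes H: "subgroup H (BijGroup \<Omega>)" and K: "subgroup K (BijGroup \<Omega>)"
    and eq: "Orb2 \<Omega> K = Orb2 \<Omega> H"
  shows "K \<subseteq> pairwise_hull \<Omega> H"
proof
  note H' = H[unfolded subgroup_BijGroup_iff] and K' = K[unfolded subgroup_BijGroup_iff]
  fix f assume f: "f \<in> K"
  have "\<exists>h\<in>H. h x = f x \<and> h y = f y" if xy: "x \<in> \<Omega>" "y \<in> \<Omega>" for x y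
  proof -
    have "{(h x, h y) | h. h \<in> K} \<in> Orb2 \<Omega> K"
      unfolding Orb2_eq mem_Collect_eq by (rule exI[of _ x], rule exI[of _ y], rule conjI[OF refl conjI[OF xy]])
    then have "\<exists>a b. {(h x, h y) | h. h \<in> K} = {(h a, h b) | h. h \<in> H} \<and> a \<in> \<Omega> \<and> b \<in> \<Omega>"
      unfolding eq by (subst (asm) Orb2_eq) (simp only: mem_Collect_eq)
    then obtain a b where ab: "a \<in> \<Omega>" "b \<in> \<Omega>"
      and O: "{(h x, h y) | h. h \<in> K} = {(h a, h b) | h. h \<in> H}"
      by (elim exE conjE)
    have "(\<lambda>x\<in>\<Omega>. x) \<in> K" using K' by blast
    moreover have "(x, y) = ((\<lambda>x\<in>\<Omega>. x) x, (\<lambda>x\<in>\<Omega>. x) y)" using xy by simp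
    ultimately have "(x, y) \<in> {(h x, h y) | h. h \<in> K}" by blast
    then obtain h where h: "h \<in> H" "h a = x" "h b = y"
      unfolding O by auto
    have "(f x, f y) \<in> {(h x, h y) | h. h \<in> K}" using f by blast
    then obtain k where k: "k \<in> H" "k a = f x" "k b = f y"
      unfolding O by auto
    let ?i = "\<lambda>x\<in>\<Omega>. inv_into \<Omega> h x"
    have "inj_on h \<Omega>" using H' h by (auto simp: Bij_def bij_betw_def)
    then have "inv_into \<Omega> h x = a" "inv_into \<Omega> h y = b"
      using ab h by (intro inv_into_f_eq; simp)+
    then have "compose \<Omega> k ?i x = f x \<and> compose \<Omega> k ?i y = f y"
      using k xy by (simp add: compose_eq)
    moreover have "compose \<Omega> k ?i \<in> H" using H' h k by blast
    ultimately show ?thesis by blast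
  qed
  then show "f \<in> pairwise_hull \<Omega> H"
    using f K' by (auto simp: pairwise_hull_def)
qed

lemma two_closure_eq:
  assumes "subgroup H (BijGroup \<Omega>)"
  shows "two_closure \<Omega> H = pairwise_hull \<Omega> H"
  unfolding two_closure_def
  using subgroup_pairwise_hull[OF assms] Orb2_pairwise_hull[OF assms] subset_pairwise_hull[OF assms]
  by (intro Greatest_equality) auto

lemma two_closure_is_greatest:
  assumes "subgroup H (BijGroup \<Omega>)"
  shows "subgroup (two_closure \<Omega> H) (BijGroup \<Omega>)"
    and "Orb2 \<Omega> (two_closure \<Omega> H) = Orb2 \<Omega> H"
    and "\<And>K. subgroup K (BijGroup \<Omega>) \<Longrightarrow> Orb2 \<Omega> K = Orb2 \<Omega> H \<Longrightarrow> K \<subseteq> two_closure \<Omega> H"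
  using subgroup_pairwise_hull[OF assms] Orb2_pairwise_hull[OF assms] subset_pairwise_hull[OF assms]
  by (auto simp: two_closure_eq[OF assms])

end

theory Submission
  imports Defs
begin

text \<open>
  An abelian group acts regularly on each of its orbits, so an element of \<open>G\<close> is determined on an
  orbit by its value at one point, and the 2-closure of \<open>G\<close> consists of the permutations that agree
  with an element of \<open>G\<close> on every union of two orbits. If \<open>z\<close> is in \<open>Zel(G)\<close> and \<open>\<Delta> \<noteq> \<Delta>'\<close> are
  orbits, then \<open>z\<close> agrees on \<open>\<Delta>\<close> with an element \<open>g\<close> of \<open>G\<close> fixing \<open>\<Delta>'\<close>, and on \<open>\<Delta>'\<close> with an
  element \<open>g'\<close> fixing \<open>\<Delta>\<close>, hence with \<open>g g'\<close> on both; so \<open>Zel(G)\<close> is contained in the 2-closure.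

  The rest only uses that \<open>Z \<le> G\<close> is the direct product of its restrictions to the \<open>G\<close>-orbits. A
  permutation \<open>f\<close> in the 2-closure of \<open>G\<close> acts on the \<open>Z\<close>-orbits as an element of the 2-closure of
  the induced group; if that action is induced by \<open>g \<in> G\<close>, then \<open>g\<^sup>-\<^sup>1 f\<close> agrees on each \<open>G\<close>-orbit
  with an element of \<open>Z\<close>, so it is in \<open>Z\<close>. Conversely, an element of the 2-closure of the induced
  group lifts, one \<open>G\<close>-orbit at a time, to a map which agrees with elements of \<open>G\<close> on pairs of
  orbits, because \<open>Z\<close> allows independent corrections on two different orbits.
\<close>

section \<open>Block permutations and the pairwise hull\<close>

lemma Orb_eq: "Orb \<Omega> H = (\<lambda>x. {h x | h. h \<in> H}) ` \<Omega>"
  by (auto simp: Orb_def orbits_def orbit_def)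

text \<open>Surjectivity holds because the image map turns \<open>P x\<close> into
  \<open>P (f x)\<close> and \<open>f\<close> is onto. Stated for a single bijection, so that it
  also covers permutations of the hull not yet known to lie in the group.\<close>

lemma Bij_image_blocks:
  assumes f: "f \<in> Bij \<Omega>" and P: "\<And>x. x \<in> \<Omega> \<Longrightarrow> P x \<subseteq> \<Omega>"
    and im: "\<And>x. x \<in> \<Omega> \<Longrightarrow> f ` P x = P (f x)"
  shows "(\<lambda>B\<in>P ` \<Omega>. f ` B) \<in> Bij (P ` \<Omega>)"
proof -
  have bij: "inj_on f \<Omega>" "f ` \<Omega> = \<Omega>" using f by (auto simp: Bij_def bij_betw_def)
  have "inj_on (\<lambda>B. f ` B) (P ` \<Omega>)"
    using P by (intro inj_on_subset[OF inj_on_image_Pow[OF bij(1)]]) auto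
  moreover have "(\<lambda>B. f ` B) ` P ` \<Omega> = P ` \<Omega>"
  proof -
    have "(\<lambda>B. f ` B) ` P ` \<Omega> = P ` f ` \<Omega>" using im by (simp add: image_image)
    then show ?thesis using bij(2) by simp
  qed
  ultimately have "bij_betw (\<lambda>B. f ` B) (P ` \<Omega>) (P ` \<Omega>)" by (simp add: bij_betw_def)
  then show ?thesis by (simp add: Bij_def bij_betw_restrict_eq)
qed

lemma pairwise_hull_superset:
  assumes "subgroup H (BijGroup \<Omega>)"
  shows "H \<subseteq> pairwise_hull \<Omega> H"
  using assms by (rule subset_pairwise_hull) (rule assms, rule refl)

lemma two_closed_iff:
  assumes "subgroup H (BijGroup \<Omega>)"
  shows "two_closed \<Omega> H \<longleftrightarrow> pairwise_hull \<Omega> H \<subseteq> H"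
  using pairwise_hull_superset[OF assms] by (auto simp: two_closed_def two_closure_eq[OF assms])

section \<open>Abelian permutation groups: regularity on orbits and recognition of the hull\<close>

locale abelian_perm =
  fixes \<Omega> :: "'a set" and G :: "('a \<Rightarrow> 'a) set"
  assumes subgroup_G: "subgroup G (BijGroup \<Omega>)"
    and commute: "\<lbrakk>g \<in> G; h \<in> G; x \<in> \<Omega>\<rbrakk> \<Longrightarrow> g (h x) = h (g x)"
begin

lemma G_Bij: "g \<in> G \<Longrightarrow> g \<in> Bij \<Omega>"
  using subgroup_G by (auto simp: subgroup_BijGroup_iff)

lemma G_closed: "g \<in> G \<Longrightarrow> x \<in> \<Omega> \<Longrightarrow> g x \<in> \<Omega>"
  using G_Bij by (auto simp: Bij_def bij_betw_def)

lemma G_inj: "\<lbrakk>g \<in> G; x \<in> \<Omega>; y \<in> \<Omega>; g x = g y\<rbrakk> \<Longrightarrow> x = y"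
  using G_Bij by (auto simp: Bij_def bij_betw_def inj_on_def)

lemma G_id: "(\<lambda>x\<in>\<Omega>. x) \<in> G"
  using subgroup_G by (simp add: subgroup_BijGroup_iff)

lemma G_compose: "\<lbrakk>g \<in> G; h \<in> G\<rbrakk> \<Longrightarrow> compose \<Omega> g h \<in> G"
  using subgroup_G by (simp add: subgroup_BijGroup_iff)

lemma G_inv: "g \<in> G \<Longrightarrow> (\<lambda>x\<in>\<Omega>. inv_into \<Omega> g x) \<in> G"
  using subgroup_G by (simp add: subgroup_BijGroup_iff)

lemma G_inv_apply: "g \<in> G \<Longrightarrow> x \<in> \<Omega> \<Longrightarrow> inv_into \<Omega> g (g x) = x"
  using G_Bij by (auto simp: Bij_def bij_betw_def)

lemma G_apply_inv: "g \<in> G \<Longrightarrow> x \<in> \<Omega> \<Longrightarrow> g (inv_into \<Omega> g x) = x"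
  using G_Bij by (auto simp: Bij_def bij_betw_def f_inv_into_f)

text \<open>Depends on the group alone, so that all orbit facts can be reused for a subgroup
  \<open>Z\<close> through \<open>zorb\<close>.\<close>

definition orb :: "'a \<Rightarrow> 'a set" where "orb x = {g x | g. g \<in> G}"

lemma orbI: "g \<in> G \<Longrightarrow> g x \<in> orb x"
  by (auto simp: orb_def)

lemma orbE: assumes "y \<in> orb x" obtains g where "g \<in> G" "y = g x"
  using assms by (auto simp: orb_def)

lemma orb_refl: "x \<in> \<Omega> \<Longrightarrow> x \<in> orb x"
  using orbI[OF G_id, of x] by simp

lemma orb_subset: "x \<in> \<Omega> \<Longrightarrow> orb x \<subseteq> \<Omega>"
  by (auto simp: orb_def G_closed)

lemma orb_eq:
  assumes x: "x \<in> \<Omega>" and y: "y \<in> orb x"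
  shows "orb y = orb x"
proof -
  have sub: "orb b \<subseteq> orb a" if a: "a \<in> \<Omega>" and b: "b \<in> orb a" for a b
  proof -
    obtain g where g: "g \<in> G" "b = g a" using orbE[OF b] .
    show ?thesis
    proof
      fix c assume "c \<in> orb b"
      then obtain h where "h \<in> G" "c = h b" by (rule orbE)
      then show "c \<in> orb a"
        using orbI[OF G_compose[of h g], of a] g a by (simp add: compose_eq)
    qed
  qed
  obtain g where g: "g \<in> G" "y = g x" using orbE[OF y] .
  then have "x \<in> orb y"
    using orbI[OF G_inv[OF g(1)], of y] G_inv_apply[OF g(1) x] G_closed[OF g(1) x] by simp
  moreover have "y \<in> \<Omega>" using g x G_closed by simp
  ultimately show ?thesis using sub x y by blast
qed

lemma orb_apply: "x \<in> \<Omega> \<Longrightarrow> g \<in> G \<Longrightarrow> orb (g x) = orb x"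
  by (rule orb_eq) (auto intro: orbI)

lemma Orb_G: "Orb \<Omega> G = orb ` \<Omega>"
  by (simp add: Orb_eq orb_def)

text \<open>With \<open>u = k x\<close>, commutativity gives
  \<open>g (k x) = k (g x) = k (h x) = h (k x)\<close>.\<close>

lemma regular:
  assumes "g \<in> G" "h \<in> G" "x \<in> \<Omega>" "g x = h x" "u \<in> orb x"
  shows "g u = h u"
  using assms by (metis commute orbE)

text \<open>An element of \<open>G\<close> matching \<open>f\<close> at \<open>x\<close> and
  \<open>u\<close> agrees with \<open>g\<close> at \<open>x\<close>, hence at \<open>u\<close> by
  regularity. Asking only for pairwise agreement makes this available before \<open>f\<close> is
  known to be bijective.\<close>

lemma agree_on_orb:
  assumes f: "\<And>x y. \<lbrakk>x \<in> \<Omega>; y \<in> \<Omega>\<rbrakk> \<Longrightarrow> \<exists>h\<in>G. h x = f x \<and> h y = f y"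
    and g: "g \<in> G" "g x = f x" and x: "x \<in> \<Omega>" and u: "u \<in> orb x"
  shows "f u = g u"
proof -
  obtain h where "h \<in> G" "h x = f x" "h u = f u"
    using f[OF x] u orb_subset[OF x] by blast
  then show ?thesis using regular[of g h x u] g x u by simp
qed

lemma pairwise_hull_apply:
  assumes f: "f \<in> pairwise_hull \<Omega> G" and g: "g \<in> G" "g x = f x" and x: "x \<in> \<Omega>" and u: "u \<in> orb x"
  shows "f u = g u"
  by (rule agree_on_orb[where f = f, OF _ g x u]) (meson f pairwise_hullE)

text \<open>Two points are separated by the element of \<open>G\<close> that matches
  \<open>f\<close> on both; and on each orbit \<open>f\<close> coincides with one element of
  \<open>G\<close>, which permutes that orbit.\<close>

lemma pairwise_hullI:
  assumes ext: "f \<in> extensional \<Omega>"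
    and f: "\<And>x y. \<lbrakk>x \<in> \<Omega>; y \<in> \<Omega>\<rbrakk> \<Longrightarrow> \<exists>h\<in>G. h x = f x \<and> h y = f y"
  shows "f \<in> pairwise_hull \<Omega> G"
proof -
  have "inj_on f \<Omega>"
  proof (rule inj_onI)
    fix x y assume xy: "x \<in> \<Omega>" "y \<in> \<Omega>" "f x = f y"
    obtain h where "h \<in> G" "h x = f x" "h y = f y" using f xy by blast
    then show "x = y" using xy G_inj[of h x y] by simp
  qed
  moreover have "f ` \<Omega> = \<Omega>"
  proof
    show "f ` \<Omega> \<subseteq> \<Omega>"
    proof (rule image_subsetI)
      fix x assume x: "x \<in> \<Omega>"
      obtain h where "h \<in> G" "h x = f x" using f[OF x x] by blast
      then show "f x \<in> \<Omega>" using G_closed x by metis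
    qed
    show "\<Omega> \<subseteq> f ` \<Omega>"
    proof
      fix y assume y: "y \<in> \<Omega>"
      obtain h where h: "h \<in> G" "h y = f y" using f[OF y y] by blast
      let ?u = "inv_into \<Omega> h y"
      have u: "?u \<in> orb y" using orbI[OF G_inv[OF h(1)], of y] y by simp
      have "f ?u = h ?u" by (rule agree_on_orb[OF f h y u])
      also have "\<dots> = y" by (rule G_apply_inv[OF h(1) y])
      finally show "y \<in> f ` \<Omega>" using u orb_subset[OF y] by (metis image_eqI subsetD)
    qed
  qed
  ultimately show ?thesis
    using ext f by (simp add: pairwise_hull_def Bij_def bij_betw_def)
qed

end

section \<open>Passage to the action on the orbits of an orbitwise subgroup\<close>

text \<open>The assumption \<open>paste\<close> expresses that \<open>Z\<close> is the direct
  product of its restrictions to the \<open>G\<close>-orbits: its elements may be chosen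
  independently on each.\<close>

locale orbitwise_subgroup = abelian_perm +
  fixes Z :: "('a \<Rightarrow> 'a) set"
  assumes subgroup_Z: "subgroup Z (BijGroup \<Omega>)"
    and Z_subset: "Z \<subseteq> G"
    and paste: "\<lbrakk>f \<in> extensional \<Omega>; \<And>x. x \<in> \<Omega> \<Longrightarrow> \<exists>z\<in>Z. \<forall>u\<in>orb x. f u = z u\<rbrakk> \<Longrightarrow> f \<in> Z"
begin

lemma abelian_Z: "abelian_perm \<Omega> Z"
  using Z_subset commute by (intro abelian_perm.intro subgroup_Z) blast

abbreviation zorb :: "'a \<Rightarrow> 'a set" where "zorb x \<equiv> abelian_perm.orb Z x"

lemmas zorb_def = abelian_perm.orb_def[OF abelian_Z]
lemmas zorb_refl = abelian_perm.orb_refl[OF abelian_Z]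
lemmas zorb_subset = abelian_perm.orb_subset[OF abelian_Z]
lemmas Orb_Z = abelian_perm.Orb_G[OF abelian_Z]

lemma zorb_subset_orb: "zorb x \<subseteq> orb x"
  using Z_subset by (auto simp: zorb_def orb_def)

lemma zorb_apply: "x \<in> \<Omega> \<Longrightarrow> z \<in> Z \<Longrightarrow> zorb (z x) = zorb x"
  by (rule abelian_perm.orb_apply[OF abelian_Z])

lemma zorb_eqE:
  assumes "x \<in> \<Omega>" "y \<in> \<Omega>" "zorb x = zorb y"
  obtains z where "z \<in> Z" "y = z x"
  using assms zorb_refl[of y] by (auto simp: zorb_def)

lemma image_zorb:
  assumes "g \<in> G" "x \<in> \<Omega>"
  shows "g ` zorb x = zorb (g x)"
proof -
  have "g (z x) = z (g x)" if "z \<in> Z" for z using commute that assms Z_subset by blast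
  then show ?thesis by (force simp: zorb_def)
qed

abbreviation on_blocks :: "('a \<Rightarrow> 'a) \<Rightarrow> 'a set \<Rightarrow> 'a set"
  where "on_blocks g \<equiv> \<lambda>B\<in>Orb \<Omega> Z. g ` B"

lemma on_blocks_zorb: "\<lbrakk>g \<in> G; x \<in> \<Omega>\<rbrakk> \<Longrightarrow> on_blocks g (zorb x) = zorb (g x)"
  by (simp add: Orb_Z image_zorb)

lemma subgroup_on_blocks: "subgroup (induced_on_blocks G (Orb \<Omega> Z)) (BijGroup (Orb \<Omega> Z))"
proof -
  have Bij: "on_blocks g \<in> Bij (Orb \<Omega> Z)" if "g \<in> G" for g
    unfolding Orb_Z
    using that by (intro Bij_image_blocks G_Bij zorb_subset image_zorb)
  have comp: "compose (Orb \<Omega> Z) (on_blocks g) (on_blocks h) = on_blocks (compose \<Omega> g h)"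
    if "g \<in> G" "h \<in> G" for g h
  proof (rule extensionalityI[of _ "Orb \<Omega> Z"])
    fix B assume B: "B \<in> Orb \<Omega> Z"
    then obtain x where x: "x \<in> \<Omega>" "B = zorb x" by (auto simp: Orb_Z)
    then show "compose (Orb \<Omega> Z) (on_blocks g) (on_blocks h) B = on_blocks (compose \<Omega> g h) B"
      using B that G_compose[OF that] G_closed
      by (simp add: compose_eq on_blocks_zorb del: restrict_apply)
  qed auto
  have one: "on_blocks (\<lambda>x\<in>\<Omega>. x) = (\<lambda>B\<in>Orb \<Omega> Z. B)"
    using zorb_subset by (intro restrict_ext) (force simp: Orb_Z)
  have inv: "(\<lambda>B\<in>Orb \<Omega> Z. inv_into (Orb \<Omega> Z) (on_blocks g) B) = on_blocks (\<lambda>x\<in>\<Omega>. inv_into \<Omega> g x)"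
    if g: "g \<in> G" for g
  proof (rule extensionalityI[of _ "Orb \<Omega> Z"])
    fix B assume B: "B \<in> Orb \<Omega> Z"
    then obtain x where x: "x \<in> \<Omega>" "B = zorb x" by (auto simp: Orb_Z)
    let ?x = "inv_into \<Omega> g x"
    have x': "?x \<in> \<Omega>" using G_closed[OF G_inv[OF g] x(1)] x(1) by simp
    have "on_blocks g (zorb ?x) = B"
      using on_blocks_zorb[OF g x'] G_apply_inv[OF g x(1)] x(2) by simp
    moreover have "inj_on (on_blocks g) (Orb \<Omega> Z)"
      using Bij[OF g] by (auto simp: Bij_def bij_betw_def)
    moreover have "zorb ?x \<in> Orb \<Omega> Z" using x' by (simp add: Orb_Z)
    ultimately have "inv_into (Orb \<Omega> Z) (on_blocks g) B = zorb ?x" by (intro inv_into_f_eq)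
    then show "(\<lambda>B\<in>Orb \<Omega> Z. inv_into (Orb \<Omega> Z) (on_blocks g) B) B = on_blocks (\<lambda>x\<in>\<Omega>. inv_into \<Omega> g x) B"
      using B x on_blocks_zorb[OF G_inv[OF g] x(1)] by simp
  qed auto
  show ?thesis
    unfolding subgroup_BijGroup_iff induced_on_blocks_def
  proof (intro conjI ballI)
    show "on_blocks ` G \<subseteq> Bij (Orb \<Omega> Z)" using Bij by blast
    show "(\<lambda>B\<in>Orb \<Omega> Z. B) \<in> on_blocks ` G" using one G_id by (metis image_eqI)
    show "compose (Orb \<Omega> Z) \<phi> \<psi> \<in> on_blocks ` G" if \<phi>: "\<phi> \<in> on_blocks ` G" and \<psi>: "\<psi> \<in> on_blocks ` G" for \<phi> \<psi>
    proof -
      obtain g h where "g \<in> G" "\<phi> = on_blocks g" "h \<in> G" "\<psi> = on_blocks h"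
        using \<phi> \<psi> by blast
      then show ?thesis by (simp only: comp) (intro imageI G_compose)
    qed
    show "(\<lambda>B\<in>Orb \<Omega> Z. inv_into (Orb \<Omega> Z) \<phi> B) \<in> on_blocks ` G" if \<phi>: "\<phi> \<in> on_blocks ` G" for \<phi>
    proof -
      obtain g where "g \<in> G" "\<phi> = on_blocks g" using \<phi> by blast
      then show ?thesis by (simp only: inv) (intro imageI G_inv)
    qed
  qed
qed

lemma two_closed_imp_on_blocks:
  assumes hull: "pairwise_hull \<Omega> G \<subseteq> G"
  shows "pairwise_hull (Orb \<Omega> Z) (induced_on_blocks G (Orb \<Omega> Z)) \<subseteq> induced_on_blocks G (Orb \<Omega> Z)"
proof
  fix \<phi> assume \<phi>: "\<phi> \<in> pairwise_hull (Orb \<Omega> Z) (induced_on_blocks G (Orb \<Omega> Z))"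
  have pair: "\<exists>h\<in>G. zorb (h x) = \<phi> (zorb x) \<and> zorb (h y) = \<phi> (zorb y)"
    if xy: "x \<in> \<Omega>" "y \<in> \<Omega>" for x y
  proof -
    have "zorb x \<in> Orb \<Omega> Z" "zorb y \<in> Orb \<Omega> Z" using xy by (auto simp: Orb_Z)
    then obtain \<psi> where \<psi>: "\<psi> \<in> induced_on_blocks G (Orb \<Omega> Z)"
      "\<psi> (zorb x) = \<phi> (zorb x)" "\<psi> (zorb y) = \<phi> (zorb y)"
      using pairwise_hullE[OF \<phi>] by metis
    then obtain h where "h \<in> G" "\<psi> = on_blocks h" by (auto simp: induced_on_blocks_def)
    then show ?thesis using \<psi> on_blocks_zorb xy by metis
  qed
  \<comment> \<open>On one orbit an \<open>h\<close> matched at a base point \<open>x\<close> is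
    enough. If \<open>k\<close> is matched at \<open>x\<close> and \<open>u\<close>, then
    \<open>h x = z (k x)\<close> for some \<open>z\<close> in \<open>Z\<close>; by regularity
    \<open>h u = z (k u)\<close>, and \<open>z\<close> preserves the block of
    \<open>k u\<close>.\<close>
  have "\<exists>h\<in>G. \<forall>u\<in>\<Delta>. zorb (h u) = \<phi> (zorb u)" if \<Delta>: "\<Delta> \<in> orb ` \<Omega>" for \<Delta>
  proof -
    obtain x where x: "x \<in> \<Omega>" "\<Delta> = orb x" using \<Delta> by blast
    obtain h where h: "h \<in> G" "zorb (h x) = \<phi> (zorb x)" using pair[OF x(1) x(1)] by blast
    have "zorb (h u) = \<phi> (zorb u)" if u: "u \<in> orb x" for u
    proof -
      have u': "u \<in> \<Omega>" using u orb_subset x by blast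
      obtain k where k: "k \<in> G" "zorb (k x) = \<phi> (zorb x)" "zorb (k u) = \<phi> (zorb u)"
        using pair[OF x(1) u'] by blast
      obtain z where z: "z \<in> Z" "h x = z (k x)"
        using zorb_eqE[of "k x" "h x"] h k G_closed x by metis
      then have "compose \<Omega> z k \<in> G" using Z_subset k G_compose by blast
      then have "h u = compose \<Omega> z k u"
        using regular[of h "compose \<Omega> z k" x u] h z x u by (simp add: compose_eq)
      then show ?thesis using zorb_apply[of "k u" z] z k G_closed u' by (simp add: compose_eq)
    qed
    then show ?thesis using h x by blast
  qed
  \<comment> \<open>\<open>H\<close> is chosen per orbit and not per point, so that \<open>f\<close>
    coincides with one element of \<open>G\<close> on each orbit.\<close>
  then obtain H where H: "\<And>\<Delta>. \<Delta> \<in> orb ` \<Omega> \<Longrightarrow> H \<Delta> \<in> G \<and> (\<forall>u\<in>\<Delta>. zorb (H \<Delta> u) = \<phi> (zorb u))"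
    by metis
  define f where "f = (\<lambda>x\<in>\<Omega>. H (orb x) x)"
  have Hx: "H (orb x) \<in> G" if "x \<in> \<Omega>" for x using H that by blast
  have f_zorb: "zorb (f x) = \<phi> (zorb x)" if "x \<in> \<Omega>" for x
    using H[of "orb x"] that orb_refl by (simp add: f_def)
  have f_closed: "f x \<in> \<Omega>" if "x \<in> \<Omega>" for x
    using Hx[OF that] G_closed that by (simp add: f_def)
  have "f \<in> pairwise_hull \<Omega> G"
  proof (rule pairwise_hullI)
    show "f \<in> extensional \<Omega>" by (simp add: f_def)
    fix x y assume xy: "x \<in> \<Omega>" "y \<in> \<Omega>"
    show "\<exists>h\<in>G. h x = f x \<and> h y = f y"
    proof (cases "orb x = orb y")
      case True
      then show ?thesis using Hx[OF xy(1)] xy by (auto simp: f_def)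
    next
      case False
      obtain h where h: "h \<in> G" "zorb (h x) = \<phi> (zorb x)" "zorb (h y) = \<phi> (zorb y)"
        using pair[OF xy] by blast
      note hxy = G_closed[OF h(1) xy(1)] G_closed[OF h(1) xy(2)]
      obtain z where z: "z \<in> Z" "f x = z (h x)"
        using zorb_eqE[of "h x" "f x"] h f_zorb f_closed hxy xy by metis
      obtain w where w: "w \<in> Z" "f y = w (h y)"
        using zorb_eqE[of "h y" "f y"] h f_zorb f_closed hxy xy by metis
      \<comment> \<open>\<open>h\<close> hits the right blocks at \<open>x\<close> and
        \<open>y\<close> but may miss the points \<open>f x\<close> and \<open>f y\<close>. The
        corrections \<open>z\<close> and \<open>w\<close> are needed on different orbits, so they
        can be pasted into one element of \<open>Z\<close>.\<close>
      define k where "k = (\<lambda>u\<in>\<Omega>. if u \<in> orb x then z u else w u)"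
      have k: "k \<in> Z"
      proof (rule paste)
        show "k \<in> extensional \<Omega>" by (simp add: k_def)
        fix v assume v: "v \<in> \<Omega>"
        show "\<exists>t\<in>Z. \<forall>u\<in>orb v. k u = t u"
        proof (cases "orb v = orb x")
          case True
          then show ?thesis using z orb_subset[OF v] by (intro bexI[of _ z]) (auto simp: k_def)
        next
          case False
          then have "u \<notin> orb x" if "u \<in> orb v" for u using orb_eq that v xy by metis
          then show ?thesis using w orb_subset[OF v] by (intro bexI[of _ w]) (auto simp: k_def)
        qed
      qed
      have "h x \<in> orb x" using h orbI by blast
      moreover have "h y \<notin> orb x" using False orb_eq orb_apply h xy by metis
      ultimately have "compose \<Omega> k h x = f x" "compose \<Omega> k h y = f y"
        using hxy xy z w by (simp_all add: compose_eq k_def)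
      moreover have "compose \<Omega> k h \<in> G" using k Z_subset h G_compose by blast
      ultimately show ?thesis by blast
    qed
  qed
  then have f: "f \<in> G" using hull by blast
  have "\<phi> = on_blocks f"
  proof (rule extensionalityI[of _ "Orb \<Omega> Z"])
    show "\<phi> \<in> extensional (Orb \<Omega> Z)" using \<phi> by (simp add: pairwise_hull_def Bij_def)
    show "\<phi> B = on_blocks f B" if B: "B \<in> Orb \<Omega> Z" for B
    proof -
      obtain x where "x \<in> \<Omega>" "B = zorb x" using B by (auto simp: Orb_Z)
      then show ?thesis using f_zorb on_blocks_zorb[OF f] by simp
    qed
  qed simp
  then show "\<phi> \<in> induced_on_blocks G (Orb \<Omega> Z)" using f by (auto simp: induced_on_blocks_def)
qed

lemma two_closed_if_on_blocks:
  assumes hull: "pairwise_hull (Orb \<Omega> Z) (induced_on_blocks G (Orb \<Omega> Z)) \<subseteq> induced_on_blocks G (Orb \<Omega> Z)"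
  shows "pairwise_hull \<Omega> G \<subseteq> G"
proof
  fix f assume f: "f \<in> pairwise_hull \<Omega> G"
  then have Bij: "f \<in> Bij \<Omega>" by (simp add: pairwise_hull_def)
  have local_G: "\<exists>h\<in>G. \<forall>u\<in>orb x. f u = h u" if "x \<in> \<Omega>" for x
    using pairwise_hullE[OF f that that] pairwise_hull_apply[OF f] that by metis
  have im: "f ` zorb x = zorb (f x)" if x: "x \<in> \<Omega>" for x
  proof -
    obtain h where h: "h \<in> G" "\<And>u. u \<in> orb x \<Longrightarrow> f u = h u" using local_G[OF x] by blast
    then have "f ` zorb x = h ` zorb x" using zorb_subset_orb by (intro image_cong) auto
    then show ?thesis using image_zorb[OF h(1) x] h(2) orb_refl[OF x] by simp
  qed
  have "on_blocks f \<in> pairwise_hull (Orb \<Omega> Z) (induced_on_blocks G (Orb \<Omega> Z))"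
    unfolding pairwise_hull_def
  proof (intro CollectI conjI ballI)
    show "on_blocks f \<in> Bij (Orb \<Omega> Z)"
      unfolding Orb_Z by (intro Bij_image_blocks Bij zorb_subset im)
    fix B C assume BC: "B \<in> Orb \<Omega> Z" "C \<in> Orb \<Omega> Z"
    then obtain x y where xy: "x \<in> \<Omega>" "B = zorb x" "y \<in> \<Omega>" "C = zorb y" by (auto simp: Orb_Z)
    obtain h where h: "h \<in> G" "h x = f x" "h y = f y" using pairwise_hullE[OF f xy(1,3)] .
    then have "on_blocks h B = on_blocks f B \<and> on_blocks h C = on_blocks f C"
      using BC xy im image_zorb by simp
    then show "\<exists>\<psi>\<in>induced_on_blocks G (Orb \<Omega> Z). \<psi> B = on_blocks f B \<and> \<psi> C = on_blocks f C"
      using h unfolding induced_on_blocks_def by (intro bexI[of _ "on_blocks h"] imageI)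
  qed
  then obtain g where g: "g \<in> G" "on_blocks f = on_blocks g"
    using hull by (auto simp: induced_on_blocks_def)
  have same: "zorb (g x) = zorb (f x)" if "x \<in> \<Omega>" for x
    using fun_cong[OF g(2), of "zorb x"] that im image_zorb[OF g(1)] by (simp add: Orb_Z)
  \<comment> \<open>The inverse of \<open>g\<close> after \<open>f\<close>; it preserves every
    \<open>Z\<close>-orbit, and membership in \<open>Z\<close> is obtained orbit by orbit from
    \<open>paste\<close>.\<close>
  define k where "k = compose \<Omega> (\<lambda>x\<in>\<Omega>. inv_into \<Omega> g x) f"
  have f_closed: "f x \<in> \<Omega>" if "x \<in> \<Omega>" for x
    using Bij that by (auto simp: Bij_def bij_betw_def)
  have k_apply: "k x = inv_into \<Omega> g (f x)" if "x \<in> \<Omega>" for x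
    using that f_closed by (simp add: k_def compose_eq)
  have k: "k \<in> Z"
  proof (rule paste)
    show "k \<in> extensional \<Omega>" by (simp add: k_def)
    fix x assume x: "x \<in> \<Omega>"
    \<comment> \<open>The \<open>z\<close> found at \<open>x\<close> serves the whole orbit:
      \<open>f\<close> and \<open>z\<close> after \<open>g\<close> agree at \<open>x\<close>, hence
      on \<open>orb x\<close>, and commuting \<open>z\<close> past \<open>g\<close> lets
      \<open>g\<close> cancel.\<close>
    obtain z where z: "z \<in> Z" "f x = z (g x)"
      using zorb_eqE[of "g x" "f x"] same[OF x] f_closed[OF x] G_closed[OF g(1) x] by blast
    have zG: "z \<in> G" using z Z_subset by blast
    have "k u = z u" if u: "u \<in> orb x" for u
    proof -
      have u': "u \<in> \<Omega>" using u orb_subset x by blast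
      have "f u = compose \<Omega> z g u"
        by (rule pairwise_hull_apply[OF f G_compose[OF zG g(1)] _ x u]) (simp add: compose_eq x z)
      also have "\<dots> = g (z u)" using u' commute[OF zG g(1)] by (simp add: compose_eq)
      finally show ?thesis using k_apply[OF u'] G_inv_apply[OF g(1)] G_closed[OF zG u'] by simp
    qed
    then show "\<exists>z\<in>Z. \<forall>u\<in>orb x. k u = z u" using z by blast
  qed
  have "f = compose \<Omega> g k"
  proof (rule extensionalityI[of _ \<Omega>])
    show "f \<in> extensional \<Omega>" using Bij by (simp add: Bij_def)
    show "f x = compose \<Omega> g k x" if "x \<in> \<Omega>" for x
      using that k_apply G_apply_inv[OF g(1)] f_closed by (simp add: compose_eq)
  qed simp
  then show "f \<in> G" using G_compose[OF g(1)] k Z_subset by blast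
qed

lemma two_closed_iff_on_blocks:
  "two_closed \<Omega> G \<longleftrightarrow> two_closed (Orb \<Omega> Z) (induced_on_blocks G (Orb \<Omega> Z))"
  using two_closed_imp_on_blocks two_closed_if_on_blocks
  by (auto simp: two_closed_iff subgroup_G subgroup_on_blocks)

end

section \<open>The group Zel: pointwise description and group structure\<close>

context abelian_perm
begin

text \<open>The family behind \<open>z\<close> is recovered by restriction, since its member at
  \<open>orb x\<close> is extensional and agrees there with \<open>z\<close>.\<close>

lemma Zel_iff_restrict:
  "z \<in> Zel \<Omega> G \<longleftrightarrow> z \<in> extensional \<Omega> \<and> (\<forall>x\<in>\<Omega>. restrict z (orb x) \<in> Zel_factor \<Omega> G (orb x))"
  (is "?L \<longleftrightarrow> ?R")
proof
  have o: "orbit (perm_group \<Omega> G) (\<lambda>g. g) x = orb x" for x by (simp add: orbit_def orb_def)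
  {
    assume ?L
    then obtain f where f: "f \<in> (\<Pi>\<^sub>E \<Delta> \<in> orb ` \<Omega>. Zel_factor \<Omega> G \<Delta>)" and z: "z = (\<lambda>x\<in>\<Omega>. f (orb x) x)"
      by (auto simp: Zel_def o Orb_G)
    have "restrict z (orb x) = f (orb x)" if x: "x \<in> \<Omega>" for x
    proof (rule extensionalityI[of _ "orb x"])
      have "f (orb x) \<in> Zel_factor \<Omega> G (orb x)" using f x by (rule PiE_mem[OF _ imageI])
      then show "f (orb x) \<in> extensional (orb x)"
        by (auto simp: Zel_factor_def induced_def)
      show "restrict z (orb x) u = f (orb x) u" if "u \<in> orb x" for u
        using that orb_eq[OF x that] orb_subset[OF x] by (auto simp: z)
    qed simp
    then show ?R using f by (auto simp: z)
  }
  assume R: ?R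
  define f where "f = (\<lambda>\<Delta>\<in>orb ` \<Omega>. restrict z \<Delta>)"
  have f: "f \<in> (\<Pi>\<^sub>E \<Delta> \<in> orb ` \<Omega>. Zel_factor \<Omega> G \<Delta>)" using R by (auto simp: f_def)
  have z: "z = (\<lambda>x\<in>\<Omega>. f (orb x) x)"
    using R orb_refl by (intro extensionalityI[of _ \<Omega>]) (auto simp: f_def)
  show ?L unfolding Zel_def o Orb_G by (rule image_eqI[OF _ f]) (rule z)
qed

text \<open>By regularity an element of \<open>G\<close> fixes an orbit pointwise as soon as it
  fixes one of its points, so the intersection over the other orbits becomes a condition on points
  \<open>y\<close> outside \<open>orb x\<close>.\<close>

lemma Zel_iff:
  "z \<in> Zel \<Omega> G \<longleftrightarrow> z \<in> extensional \<Omega> \<and>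
     (\<forall>x\<in>\<Omega>. (\<exists>g\<in>G. \<forall>u\<in>orb x. z u = g u) \<and>
       (\<forall>y\<in>\<Omega> - orb x. \<exists>g\<in>G. g y = y \<and> (\<forall>u\<in>orb x. z u = g u)))"
proof -
  have res: "restrict z D = restrict g D \<longleftrightarrow> (\<forall>u\<in>D. z u = g u)" for g D
    by (metis restrict_apply' restrict_ext)
  have fix_iff: "(\<forall>u\<in>orb y. g u = u) \<longleftrightarrow> g y = y" if "g \<in> G" "y \<in> \<Omega>" for g y
  proof
    show "g y = y" if "\<forall>u\<in>orb y. g u = u" using that orb_refl \<open>y \<in> \<Omega>\<close> by blast
    assume "g y = y"
    then have "g u = (\<lambda>x\<in>\<Omega>. x) u" if "u \<in> orb y" for u
      using regular[OF \<open>g \<in> G\<close> G_id \<open>y \<in> \<Omega>\<close> _ that] \<open>y \<in> \<Omega>\<close> by simp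
    then show "\<forall>u\<in>orb y. g u = u" using orb_subset[OF \<open>y \<in> \<Omega>\<close>] by (simp add: subset_iff)
  qed
  have other: "(\<forall>\<Delta>'\<in>orb ` \<Omega> - {orb x}. P \<Delta>') \<longleftrightarrow> (\<forall>y\<in>\<Omega> - orb x. P (orb y))" if "x \<in> \<Omega>" for x P
    using orb_eq[OF that] orb_refl by blast
  have "restrict z (orb x) \<in> Zel_factor \<Omega> G (orb x) \<longleftrightarrow> (\<exists>g\<in>G. \<forall>u\<in>orb x. z u = g u) \<and>
       (\<forall>y\<in>\<Omega> - orb x. \<exists>g\<in>G. g y = y \<and> (\<forall>u\<in>orb x. z u = g u))" if "x \<in> \<Omega>" for x
    unfolding Zel_factor_def Orb_G Int_iff INT_iff other[OF that] induced_def image_iff res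
      pointwise_stabilizer_def
    by (simp add: fix_iff conj_assoc flip: Bex_def cong: conj_cong)
  then show ?thesis unfolding Zel_iff_restrict by simp
qed

text \<open>Both conditions of \<open>Zel_iff\<close> at \<open>x\<close> involve only the values on
  \<open>orb x\<close>. This supplies \<open>paste\<close>.\<close>

lemma Zel_paste:
  assumes "f \<in> extensional \<Omega>" "\<And>x. x \<in> \<Omega> \<Longrightarrow> \<exists>z\<in>Zel \<Omega> G. \<forall>u\<in>orb x. f u = z u"
  shows "f \<in> Zel \<Omega> G"
  unfolding Zel_iff
proof (intro conjI ballI)
  fix x assume x: "x \<in> \<Omega>"
  obtain z where z: "z \<in> Zel \<Omega> G" "\<And>u. u \<in> orb x \<Longrightarrow> f u = z u" using assms(2)[OF x] by blast
  show "\<exists>g\<in>G. \<forall>u\<in>orb x. f u = g u" using z x by (simp add: Zel_iff)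
  show "\<exists>g\<in>G. g y = y \<and> (\<forall>u\<in>orb x. f u = g u)" if "y \<in> \<Omega> - orb x" for y
    using z x that by (simp add: Zel_iff)
qed (rule assms)

lemma Zel_subset_pairwise_hull: "Zel \<Omega> G \<subseteq> pairwise_hull \<Omega> G"
proof
  fix z assume z: "z \<in> Zel \<Omega> G"
  show "z \<in> pairwise_hull \<Omega> G"
  proof (rule pairwise_hullI)
    show "z \<in> extensional \<Omega>" using z by (simp add: Zel_iff)
    fix x y assume xy: "x \<in> \<Omega>" "y \<in> \<Omega>"
    show "\<exists>h\<in>G. h x = z x \<and> h y = z y"
    proof (cases "y \<in> orb x")
      case True
      obtain g where "g \<in> G" "\<And>u. u \<in> orb x \<Longrightarrow> z u = g u" using z xy unfolding Zel_iff by blast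
      then show ?thesis using True orb_refl[OF xy(1)] by metis
    next
      case False
      then have "x \<notin> orb y" using orb_eq orb_refl xy by metis
      then obtain h where h: "h \<in> G" "h x = x" "z y = h y"
        using z xy orb_refl[OF xy(2)] unfolding Zel_iff by blast
      obtain g where g: "g \<in> G" "g y = y" "z x = g x"
        using z xy False orb_refl[OF xy(1)] unfolding Zel_iff by blast
      have "compose \<Omega> g h x = z x" using g h xy by (simp add: compose_eq)
      moreover have "compose \<Omega> g h y = z y" using commute[of g h y] g h xy by (simp add: compose_eq)
      ultimately show ?thesis using G_compose g h by blast
    qed
  qed
qed

text \<open>Once \<open>z\<close> lies in \<open>G\<close>, regularity lets agreement at
  \<open>x\<close> replace agreement on \<open>orb x\<close>, and \<open>z\<close> itself witnesses
  the first clause of \<open>Zel_iff\<close>.\<close>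

lemma Zel_iff_of_mem:
  assumes "z \<in> G"
  shows "z \<in> Zel \<Omega> G \<longleftrightarrow> (\<forall>x\<in>\<Omega>. \<forall>y\<in>\<Omega> - orb x. \<exists>g\<in>G. g y = y \<and> g x = z x)"
proof -
  have eq: "(\<forall>u\<in>orb x. z u = g u) \<longleftrightarrow> g x = z x" if "x \<in> \<Omega>" "g \<in> G" for x g
    using regular[OF assms that(2,1)] orb_refl[OF that(1)] by metis
  have "z \<in> extensional \<Omega>" using G_Bij[OF assms] by (simp add: Bij_def)
  moreover have "\<exists>g\<in>G. \<forall>u\<in>orb x. z u = g u" for x using assms by blast
  moreover have "\<exists>g\<in>G. g x = z x" for x using assms by blast
  ultimately show ?thesis by (simp add: Zel_iff eq cong: bex_cong)
qed

text \<open>Products and inverses of witnesses fixing \<open>y\<close> again fix \<open>y\<close>;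
  the inclusion in \<open>G\<close> gives access to the one-point criterion.\<close>

lemma subgroup_Zel:
  assumes sub: "Zel \<Omega> G \<subseteq> G"
  shows "subgroup (Zel \<Omega> G) (BijGroup \<Omega>)"
  unfolding subgroup_BijGroup_iff
proof (intro conjI ballI)
  show "Zel \<Omega> G \<subseteq> Bij \<Omega>" using sub G_Bij by blast
  show "(\<lambda>x\<in>\<Omega>. x) \<in> Zel \<Omega> G"
    unfolding Zel_iff_of_mem[OF G_id] using G_id by (intro ballI bexI[of _ "\<lambda>x\<in>\<Omega>. x"]) auto
next
  fix z w assume zw: "z \<in> Zel \<Omega> G" "w \<in> Zel \<Omega> G"
  then have G: "z \<in> G" "w \<in> G" using sub by auto
  show "compose \<Omega> z w \<in> Zel \<Omega> G"
    unfolding Zel_iff_of_mem[OF G_compose[OF G]]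
  proof (intro ballI)
    fix x y assume xy: "x \<in> \<Omega>" "y \<in> \<Omega> - orb x"
    obtain g h where gh: "g \<in> G" "g y = y" "g x = z x" "h \<in> G" "h y = y" "h x = w x"
      using zw xy Zel_iff_of_mem G by meson
    \<comment> \<open>Both sides equal \<open>w (z x)\<close>, as \<open>w\<close> commutes with
      \<open>g\<close> and \<open>z\<close>.\<close>
    have "g (w x) = z (w x)" using gh G xy commute by metis
    then show "\<exists>g\<in>G. g y = y \<and> g x = compose \<Omega> z w x"
      using gh xy G_compose by (intro bexI[of _ "compose \<Omega> g h"]) (auto simp: compose_eq)
  qed
next
  fix z assume z: "z \<in> Zel \<Omega> G"
  then have G: "z \<in> G" using sub by auto
  show "(\<lambda>x\<in>\<Omega>. inv_into \<Omega> z x) \<in> Zel \<Omega> G"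
    unfolding Zel_iff_of_mem[OF G_inv[OF G]]
  proof (intro ballI)
    fix x y assume xy: "x \<in> \<Omega>" "y \<in> \<Omega> - orb x"
    let ?x = "inv_into \<Omega> z x"
    have x': "?x \<in> orb x" using orbI[OF G_inv[OF G], of x] xy by simp
    have "?x \<in> \<Omega>" using x' orb_subset xy by blast
    \<comment> \<open>The witness is taken at the preimage \<open>?x\<close> and not at
      \<open>x\<close>: then \<open>g ?x = z ?x = x\<close>, and inverting \<open>g\<close> gives
      the required value at \<open>x\<close>.\<close>
    have "y \<in> \<Omega> - orb ?x" unfolding orb_eq[OF xy(1) x'] by (rule xy(2))
    then obtain g where g: "g \<in> G" "g y = y" "g ?x = z ?x"
      using z \<open>?x \<in> \<Omega>\<close> Zel_iff_of_mem[OF G] by meson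
    have "g ?x = x" using g G_apply_inv[OF G xy(1)] by simp
    then have "inv_into \<Omega> g x = ?x" "inv_into \<Omega> g y = y"
      using G_inv_apply[OF g(1), of ?x] G_inv_apply[OF g(1), of y] g xy \<open>?x \<in> \<Omega>\<close> by auto
    then show "\<exists>g\<in>G. g y = y \<and> g x = (\<lambda>x\<in>\<Omega>. inv_into \<Omega> z x) x"
      using xy G_inv[OF g(1)] by (intro bexI[of _ "\<lambda>x\<in>\<Omega>. inv_into \<Omega> g x"]) auto
  qed
qed

text \<open>Either side yields the inclusion of \<open>Zel \<Omega> G\<close> in \<open>G\<close>,
  the left one through the hull. That inclusion makes \<open>Zel \<Omega> G\<close> an
  \<open>orbitwise_subgroup\<close>, so the comparison on blocks applies.\<close>

lemma two_closed_iff_Zel: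
  "two_closed \<Omega> G \<longleftrightarrow>
    Zel \<Omega> G \<subseteq> G \<and> two_closed (Orb \<Omega> (Zel \<Omega> G)) (induced_on_blocks G (Orb \<Omega> (Zel \<Omega> G)))"
proof -
  have "Zel \<Omega> G \<subseteq> G" if "two_closed \<Omega> G"
    using that Zel_subset_pairwise_hull by (auto simp: two_closed_iff[OF subgroup_G])
  moreover have "orbitwise_subgroup \<Omega> G (Zel \<Omega> G)" if "Zel \<Omega> G \<subseteq> G"
    by (intro orbitwise_subgroup.intro orbitwise_subgroup_axioms.intro abelian_perm_axioms
        subgroup_Zel that Zel_paste)
  ultimately show ?thesis using orbitwise_subgroup.two_closed_iff_on_blocks by blast
qed

end

theorem theorem1p3:
  fixes \<Omega> :: "'a set" and G Z :: "('a \<Rightarrow> 'a) set"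
  assumes "finite \<Omega>"
    and "subgroup G (BijGroup \<Omega>)"
    and "comm_group (perm_group \<Omega> G)"
    and "Z = Zel \<Omega> G"
  shows "two_closed \<Omega> G \<longleftrightarrow>
    subgroup Z (perm_group \<Omega> G) \<and> two_closed (Orb \<Omega> Z) (induced_on_blocks G (Orb \<Omega> Z))"
proof -
  interpret abelian_perm \<Omega> G
  proof (rule abelian_perm.intro)
    show "subgroup G (BijGroup \<Omega>)" by fact
    then have Bij: "G \<subseteq> Bij \<Omega>" by (simp add: subgroup_BijGroup_iff)
    fix g h x assume *: "g \<in> G" "h \<in> G" "x \<in> \<Omega>"
    have "compose \<Omega> g h = compose \<Omega> h g"
      using comm_monoid.m_comm[OF comm_group.axioms(1)[OF assms(3)], of g h] * Bij
      by (simp add: BijGroup_def subset_iff)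
    then show "g (h x) = h (g x)" using * by (metis compose_eq)
  qed
  \<comment> \<open>Inclusion suffices because an included \<open>Z\<close> is already a subgroup of
    the symmetric group by \<open>subgroup_Zel\<close>.\<close>
  have "subgroup Z (perm_group \<Omega> G) \<longleftrightarrow> Z \<subseteq> G"
  proof
    show "Z \<subseteq> G" if "subgroup Z (perm_group \<Omega> G)"
      using subgroup.subset[OF that] by simp
    show "subgroup Z (perm_group \<Omega> G)" if "Z \<subseteq> G"
      using group.subgroup_incl[OF group_BijGroup subgroup_Zel subgroup_G] that assms(4) by simp
  qed
  then show ?thesis using two_closed_iff_Zel assms(4) by simp
qed

end
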